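(* Let $(r_n)_{n\in\mathbb{N}}$ be a sequence of positive rational numbers such that the set $\{r_n\mid n\in\mathbb{N}\}$ is strongly bounded, and let $M=\langle r_n\mid n\in\mathbb{N}\rangle$ be the Puiseux monoid it generates. If $\mathsf{d}(r_n)$ divides $\mathsf{d}(r_{n+1})$ for every $n\in\mathbb{N}$, the sequence $(\mathsf{d}(r_n))_{n\in\mathbb{N}}$ is unbounded, and the spectrum of the sequence $(\mathsf{n}(r_n))_{n\in\mathbb{N}}$ is empty, then $M$ is antimatter.
   Context: A Puiseux monoid is an additive submonoid of $\mathbb{Q}_{\ge 0}$; $\langle S\rangle$ denotes the submonoid generated by $S$. $\mathbb{N}$ is the set of positive integers. For $r\in\mathbb{Q}_{>0}$, $\mathsf{n}(r),\mathsf{d}(r)\in\mathbb{N}$ are the unique positive integers with $r=\mathsf{n}(r)/\mathsf{d}(r)$ and $\gcd(\mathsf{n}(r),\mathsf{d}(r))=1$. A set $S$ of positive rationals is strongly bounded if its numerator set $\mathsf{n}(S)=\{\mathsf{n}(s)\mid s\in S\}$ is bounded. A sequence of integers $(a_n)$ stabilizes at a positive integer $d$ if there is $N\in\mathbb{N}$ such that $d$ divides $a_n$ for every $n\ge N$; the spectrum of $(a_n)$ is the set of primes $p$ at which $(a_n)$ stabilizes. An atom of $M$ is a nonzero $a\in M$ such that $a=x+y$ with $x,y\in M$ implies $x=0$ or $y=0$; $M$ is antimatter if it has no atoms. *)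

theory Defs
  imports Complex_Main "HOL-Computational_Algebra.Primes"
begin

(* For r > 0 these are the unique coprime positive integers with r = numer r / denom r. *)
definition numer :: "rat \<Rightarrow> int" where
  "numer r = fst (quotient_of r)"

definition denom :: "rat \<Rightarrow> int" where
  "denom r = snd (quotient_of r)"

lemma numer_denom_pos:
  assumes "r > 0"
  shows "numer r > 0" "denom r > 0" "coprime (numer r) (denom r)"
    "r = of_int (numer r) / of_int (denom r)"
proof -
  obtain a b where ab: "quotient_of r = (a, b)" by force
  have b: "b > 0" by (rule quotient_of_denom_pos[OF ab])
  have r: "r = of_int a / of_int b" by (rule quotient_of_div[OF ab])
  have "a > 0" using assms b unfolding r by (simp add: zero_less_divide_iff)
  then show "numer r > 0" "denom r > 0" "coprime (numer r) (denom r)"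
    "r = of_int (numer r) / of_int (denom r)"
    using ab b r quotient_of_coprime[OF ab] by (simp_all add: numer_def denom_def)
qed

definition add_submonoid :: "'a::monoid_add set \<Rightarrow> bool" where
  "add_submonoid M \<longleftrightarrow> 0 \<in> M \<and> (\<forall>x\<in>M. \<forall>y\<in>M. x + y \<in> M)"

definition puiseux_monoid :: "rat set \<Rightarrow> bool" where
  "puiseux_monoid M \<longleftrightarrow> add_submonoid M \<and> M \<subseteq> {0..}"

definition generated_submonoid :: "'a::monoid_add set \<Rightarrow> 'a set" where
  "generated_submonoid S = add_submonoid hull S"

lemma puiseux_monoid_generated:
  assumes "S \<subseteq> {0..}"
  shows "puiseux_monoid (generated_submonoid S)"
proof -
  have "add_submonoid (add_submonoid hull S)"
    by (rule hull_in) (auto simp: add_submonoid_def)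
  moreover have "add_submonoid hull S \<subseteq> {0..}"
    using assms by (intro hull_minimal) (auto simp: add_submonoid_def)
  ultimately show ?thesis
    by (simp add: puiseux_monoid_def generated_submonoid_def)
qed

(* Numerators of positive rationals are positive, so bounded means bounded above. *)
definition strongly_bounded :: "rat set \<Rightarrow> bool" where
  "strongly_bounded S \<longleftrightarrow> S \<subseteq> {0<..} \<and> bdd_above (numer ` S)"

definition stabilizes_at :: "(nat \<Rightarrow> int) \<Rightarrow> int \<Rightarrow> bool" where
  "stabilizes_at a d \<longleftrightarrow> d > 0 \<and> (\<exists>N. \<forall>n\<ge>N. d dvd a n)"

definition spectrum :: "(nat \<Rightarrow> int) \<Rightarrow> int set" where
  "spectrum a = {p. prime p \<and> stabilizes_at a p}"

definition atom_of :: "'a::monoid_add set \<Rightarrow> 'a \<Rightarrow> bool" where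
  "atom_of M a \<longleftrightarrow> a \<in> M \<and> a \<noteq> 0 \<and>
     (\<forall>x\<in>M. \<forall>y\<in>M. a = x + y \<longrightarrow> x = 0 \<or> y = 0)"

definition antimatter :: "'a::monoid_add set \<Rightarrow> bool" where
  "antimatter M \<longleftrightarrow> \<not> (\<exists>a. atom_of M a)"

end

theory Submission
  imports Defs "HOL-Library.Infinite_Set"
begin

text \<open>
  Write \<open>D k = denom (r k)\<close>, and consider the numerators that are available over every one of
  these denominators, that is, the set \<open>H\<close> of all naturals \<open>c\<close> with \<open>c / D k \<in> M\<close> for every
  \<open>k\<close>. It is a submonoid of the naturals. A value \<open>a\<close> that occurs infinitely often among the
  numerators \<open>numer (r n)\<close> belongs to \<open>H\<close>: for each \<open>k\<close> there is some \<open>j \<ge> k\<close> with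
  \<open>r j = a / D j\<close>, and \<open>a / D k\<close> is the multiple of \<open>r j\<close> by the integer \<open>D j / D k\<close>.
  The numerators take only finitely many values and no prime divides almost all of them, so for
  every prime some infinitely recurring value is prime to it (lemma
  \<open>recurring_value_not_dvd\<close>). Hence no prime divides all of \<open>H\<close>, and \<open>H\<close> is a numerical
  semigroup: it contains every natural from some \<open>F\<close> on (lemma \<open>numerical_semigroup_cofinite\<close>).

  Every nonzero \<open>x \<in> M\<close> is \<open>N / D k\<close> with \<open>N\<close> a natural as soon as \<open>k\<close> is large. Since
  the denominators are unbounded, \<open>N = x * D k\<close> can be made as large as desired while \<open>F\<close>
  stays fixed. Once \<open>N \<ge> 2 * (F + 1)\<close>, the splitting
  \<open>x = (F + 1) / D k + (N - (F + 1)) / D k\<close> has both summands nonzero and in \<open>M\<close>, so \<open>x\<close>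
  is not an atom.
\<close>

lemma add_submonoid_generated: "add_submonoid (generated_submonoid S)"
  unfolding generated_submonoid_def by (rule hull_in) (auto simp: add_submonoid_def)

lemma generated_submonoid_induct [consumes 1, case_names generator zero add]:
  assumes "x \<in> generated_submonoid S"
    and "\<And>s. s \<in> S \<Longrightarrow> P s" and "P 0" and "\<And>x y. P x \<Longrightarrow> P y \<Longrightarrow> P (x + y)"
  shows "P x"
proof -
  have "generated_submonoid S \<subseteq> {x. P x}"
    unfolding generated_submonoid_def
    by (rule hull_minimal) (auto simp: add_submonoid_def assms)
  with assms(1) show ?thesis
    by blast
qed

lemma add_submonoid_of_nat_mult:
  fixes M :: "'a::semiring_1 set"
  assumes "add_submonoid M" "x \<in> M"
  shows "of_nat n * x \<in> M"
  using assms by (induction n) (auto simp: add_submonoid_def algebra_simps)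

text \<open>
  The least positive difference \<open>g\<close> of two elements of \<open>H\<close> divides every element, because the
  remainder of an element modulo \<open>g\<close> is again such a difference. So \<open>g = 1\<close>, and \<open>H\<close>
  contains two consecutive numbers \<open>v\<close> and \<open>v + 1\<close>; together they generate all naturals from
  \<open>v\<^sup>2\<close> on.
\<close>

lemma numerical_semigroup_cofinite:
  fixes H :: "nat set"
  assumes H: "add_submonoid H"
    and no_common_prime: "\<And>p. prime p \<Longrightarrow> \<exists>c\<in>H. \<not> p dvd c"
  shows "\<exists>F. \<forall>n\<ge>F. n \<in> H"
proof -
  have add: "x + y \<in> H" if "x \<in> H" "y \<in> H" for x y
    using H that by (auto simp: add_submonoid_def)
  have mult: "n * x \<in> H" if "x \<in> H" for n x
    using add_submonoid_of_nat_mult[OF H that, of n] by simp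
  define Q where "Q g \<longleftrightarrow> g > 0 \<and> (\<exists>v\<in>H. v + g \<in> H)" for g
  obtain c0 where "c0 \<in> H" "\<not> 2 dvd c0"
    using no_common_prime[of 2] by auto
  then have "Q c0"
    using H by (auto simp: Q_def add_submonoid_def intro!: bexI[of _ 0] gr0I)
  define g where "g = (LEAST g. Q g)"
  have "Q g"
    unfolding g_def by (rule LeastI) fact
  then obtain v where v: "g > 0" "v \<in> H" "v + g \<in> H"
    by (auto simp: Q_def)
  have "g dvd c" if c: "c \<in> H" for c
  proof (rule ccontr)
    assume "\<not> g dvd c"
    then have s: "c mod g > 0"
      by (auto simp: dvd_eq_mod_eq_0)
    \<comment> \<open>With \<open>q = c div g\<close>, the elements \<open>q * (v + g)\<close> and \<open>c + q * v\<close> differ by \<open>c mod g\<close>.\<close>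
    have "c div g * (v + g) + c mod g = c + c div g * v"
      using div_mult_mod_eq[of c g] by (simp add: algebra_simps)
    moreover have "c + c div g * v \<in> H"
      by (intro add mult c v)
    ultimately have "Q (c mod g)"
      using s mult[OF v(3), of "c div g"] unfolding Q_def by metis
    then have "g \<le> c mod g"
      unfolding g_def by (rule Least_le)
    then show False
      using v(1) mod_less_divisor[of g c] by linarith
  qed
  then have "g = 1"
    using no_common_prime prime_factor_nat[of g] by (metis dvd_trans)
  have "n \<in> H" if n: "n \<ge> v * v" for n
  proof (cases "v = 0")
    case True
    then show ?thesis
      using mult[OF v(3), of n] \<open>g = 1\<close> by simp
  next
    case False
    then have "n mod v < v"
      by simp
    moreover have "v \<le> n div v"
      using n False by (simp add: less_eq_div_iff_mult_less_eq)
    ultimately have le: "n mod v \<le> n div v"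
      by simp
    have "(n div v - n mod v) * v + n mod v * (v + g) \<in> H"
      by (intro add mult v)
    also have "(n div v - n mod v) * v + n mod v * (v + g) = n div v * v + n mod v"
      using le \<open>g = 1\<close> by (simp add: diff_mult_distrib algebra_simps mult_le_mono)
    finally show ?thesis
      by simp
  qed
  then show ?thesis
    by blast
qed

text \<open>
  By the pigeonhole principle: the infinitely many terms that \<open>p\<close> does not divide take finitely
  many values.
\<close>

lemma recurring_value_not_dvd:
  assumes "spectrum a = {}" "finite (range a)" "prime p"
  obtains c where "\<not> p dvd c" "infinite {n. a n = c}"
proof -
  define I where "I = {n. \<not> p dvd a n}"
  have "\<not> stabilizes_at a p"
    using assms by (auto simp: spectrum_def)
  then have "\<forall>N. \<exists>n\<ge>N. n \<in> I"
    using prime_gt_0_int[OF \<open>prime p\<close>] by (auto simp: stabilizes_at_def I_def)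
  then have "infinite I"
    by (auto simp: infinite_nat_iff_unbounded_le)
  moreover have "finite (a ` I)"
    using assms(2) by (rule rev_finite_subset) auto
  ultimately obtain m where m: "m \<in> I" "infinite {n \<in> I. a n = a m}"
    using pigeonhole_infinite[of I a] by blast
  then have "infinite {n. a n = a m}"
    by (auto elim!: contrapos_nn intro: rev_finite_subset)
  with m show ?thesis
    by (intro that[of "a m"]) (auto simp: I_def)
qed

theorem theorem5p2:
  fixes r :: "nat \<Rightarrow> rat" and M :: "rat set"
  assumes pos: "\<And>n. r n > 0"
    and strongly_bounded: "strongly_bounded (range r)"
    and M: "M = generated_submonoid (range r)"
    and denom_dvd: "\<And>n. denom (r n) dvd denom (r (Suc n))"
    and denom_unbounded: "\<not> bdd_above (range (\<lambda>n. denom (r n)))"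
    and spectrum_empty: "spectrum (\<lambda>n. numer (r n)) = {}"
  shows "antimatter M"
proof -
  define D where "D k = denom (r k)" for k
  define a where "a k = numer (r k)" for k
  have D_pos: "D k > 0" and a_pos: "a k > 0" and r_eq: "r k = of_int (a k) / of_int (D k)" for k
    using numer_denom_pos[OF pos[of k]] by (simp_all add: D_def a_def)
  have D_dvd: "D i dvd D j" if "i \<le> j" for i j
    using that by (induction rule: dec_induct) (auto simp: D_def intro: dvd_trans denom_dvd)
  have M_sub: "add_submonoid M"
    unfolding M by (rule add_submonoid_generated)
  have r_in: "r k \<in> M" for k
    unfolding M generated_submonoid_def by (rule hull_inc) auto

  have spectrum_empty': "spectrum a = {}"
    using spectrum_empty by (simp add: a_def[abs_def])
  obtain B where "a n \<le> B" for n
    using strongly_bounded by (auto simp: strongly_bounded_def bdd_above_def a_def)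
  then have "range a \<subseteq> {0..B}"
    using a_pos by (force intro: less_imp_le)
  then have a_finite: "finite (range a)"
    by (rule finite_subset) simp

  define H where "H = {c::nat. \<forall>k. of_nat c / of_int (D k) \<in> M}"
  have H_sub: "add_submonoid H"
    using M_sub by (auto simp: H_def add_submonoid_def add_divide_distrib)
  have recurring_in_H: "nat c \<in> H" if inf: "infinite {n. a n = c}" for c
    unfolding H_def
  proof (intro CollectI allI)
    fix k
    obtain j where j: "j \<ge> k" "a j = c"
      using inf by (auto simp: infinite_nat_iff_unbounded_le)
    obtain e where e: "D j = D k * e"
      using D_dvd[OF j(1)] by (auto elim: dvdE)
    have "e > 0"
      using D_pos[of j] D_pos[of k] e by (simp add: zero_less_mult_iff)
    have "of_nat (nat e) * r j \<in> M"
      using add_submonoid_of_nat_mult[OF M_sub r_in] .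
    also have "of_nat (nat e) * r j = of_nat (nat c) / of_int (D k)"
      using \<open>e > 0\<close> a_pos[of j] D_pos[of k] j e by (simp add: r_eq of_nat_nat field_simps)
    finally show "of_nat (nat c) / of_int (D k) \<in> M" .
  qed
  have "\<exists>c\<in>H. \<not> p dvd c" if "prime p" for p :: nat
  proof -
    obtain c where c: "\<not> int p dvd c" "infinite {n. a n = c}"
      using recurring_value_not_dvd[OF spectrum_empty', of "int p"] a_finite \<open>prime p\<close>
      by auto
    then obtain n where "a n = c"
      using infinite_imp_nonempty by blast
    then have "\<not> p dvd nat c"
      using c(1) a_pos[of n] by (metis int_dvd_int_iff int_nat_eq less_imp_le)
    then show ?thesis
      using recurring_in_H[OF c(2)] by blast
  qed
  then obtain F where F: "\<And>n. n \<ge> F \<Longrightarrow> n \<in> H"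
    using numerical_semigroup_cofinite[OF H_sub] by blast

  have eventually_integral: "x \<ge> 0 \<and> (\<exists>K. \<forall>k\<ge>K. x * of_int (D k) \<in> \<int>)" if "x \<in> M" for x
    using that unfolding M
  proof (induction rule: generated_submonoid_induct)
    case (generator s)
    then obtain n where n: "s = r n"
      by auto
    have "r n * of_int (D k) \<in> \<int>" if "k \<ge> n" for k
    proof -
      obtain e where "D k = D n * e"
        using D_dvd[OF \<open>k \<ge> n\<close>] by (auto elim: dvdE)
      then have "r n * of_int (D k) = of_int (a n * e)"
        using D_pos[of n] by (simp add: r_eq)
      then show ?thesis
        by simp
    qed
    then show ?case
      using n pos[of n] by (auto intro: less_imp_le)
  next
    case zero
    then show ?case
      by simp
  next
    case (add x y)
    then obtain K L where "\<forall>k\<ge>K. x * of_int (D k) \<in> \<int>" "\<forall>k\<ge>L. y * of_int (D k) \<in> \<int>"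
      by auto
    then have "\<forall>k\<ge>max K L. (x + y) * of_int (D k) \<in> \<int>"
      by (auto simp: distrib_right)
    then show ?case
      using add by (meson add_nonneg_nonneg)
  qed

  have "\<not> atom_of M x" for x
  proof
    assume atom: "atom_of M x"
    then have "x \<in> M" "x \<noteq> 0"
      by (auto simp: atom_of_def)
    with eventually_integral obtain K
      where x: "x > 0" and K: "\<And>k. k \<ge> K \<Longrightarrow> x * of_int (D k) \<in> \<int>"
      by force
    obtain m where m: "of_nat (2 * (F + 1)) / x < of_int (D m)"
    proof -
      obtain m where "\<lceil>of_nat (2 * (F + 1)) / x\<rceil> < D m"
        using denom_unbounded by (auto simp: bdd_above_def D_def not_le)
      then show ?thesis
        by (intro that[of m]) (simp add: ceiling_less_iff le_less_trans[OF le_of_int_ceiling])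
    qed
    define k where "k = max K m"
    have "D m \<le> D k"
      using D_dvd[of m k] D_pos[of k] by (intro zdvd_imp_le) (auto simp: k_def)
    then have "of_nat (2 * (F + 1)) / x < of_int (D k)"
      using m by (meson less_le_trans of_int_le_iff)
    then have large: "of_nat (2 * (F + 1)) < x * of_int (D k)"
      using x by (simp add: divide_less_eq mult.commute)
    obtain z where z: "x * of_int (D k) = of_int z"
      using K[of k] by (auto simp: k_def elim: Ints_cases)
    define N where "N = nat z"
    have "of_int (int (2 * (F + 1))) < (of_int z :: rat)"
      using large z by simp
    then have "int (2 * (F + 1)) < z"
      by (simp only: of_int_less_iff)
    then have N: "2 * (F + 1) \<le> N" and zN: "z = int N"
      by (auto simp: N_def)
    have x_eq: "x = of_nat N / of_int (D k)"
      using z zN D_pos[of k] by (simp add: field_simps)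
    \<comment> \<open>Splitting off \<open>F + 1\<close> rather than \<open>F\<close> keeps both summands nonzero when \<open>F = 0\<close>.\<close>
    define y where "y = of_nat (F + 1) / (of_int (D k) :: rat)"
    define y' where "y' = of_nat (N - (F + 1)) / (of_int (D k) :: rat)"
    have "F + 1 \<in> H" "N - (F + 1) \<in> H"
      using N by (auto intro!: F)
    then have "y \<in> M" "y' \<in> M"
      unfolding H_def y_def y'_def by blast+
    moreover have "y \<noteq> 0" "y' \<noteq> 0"
      unfolding y_def y'_def using N D_pos[of k] by (auto simp del: of_nat_add of_nat_diff)
    moreover have "x = y + y'"
      unfolding x_eq y_def y'_def add_divide_distrib[symmetric] of_nat_add[symmetric]
      using N by simp
    ultimately show False
      using atom by (auto simp: atom_of_def)
  qed
  then show ?thesis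
    by (simp add: antimatter_def)
qed

end
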